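(* Let $p$ be a prime number and let $\omega=e^{2\pi i/p}$. Let $f:\mathbb{Z}_p\longrightarrow \mathbb{Z}_p$ be a function. Suppose that the average \[ \mu_f^{a,b}=\frac{1}{p}\sum_{x=0}^{p-1}\omega^{af(x)+bx} \] is an algebraic integer for every $a,b\in\mathbb{Z}_p$. Then $f$ is a linear polynomial function.
   Context: $\mathbb{Z}_p=\{0,1,\ldots,p-1\}$ denotes the ring of integers modulo $p$. For $c\in\mathbb{Z}_p$, $\omega^c$ is well defined since $\omega^p=1$. A function $f:\mathbb{Z}_p\to\mathbb{Z}_p$ is a linear polynomial function if there exist $\alpha,\beta\in\mathbb{Z}_p$ such that $f(x)=\alpha x+\beta$ in $\mathbb{Z}_p$ for all $x\in\mathbb{Z}_p$ (the case $\alpha=0$ is allowed). *)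

theory Defs
  imports "HOL-Analysis.Analysis" "HOL-Number_Theory.Number_Theory"
begin

abbreviation Zmod :: "nat \<Rightarrow> int ring" where
  "Zmod p \<equiv> residue_ring (int p)"

definition omega :: "nat \<Rightarrow> complex" where
  "omega p = exp (2 * complex_of_real pi * \<i> / of_nat p)"

text \<open>
  The carrier of \<^term>\<open>Zmod p\<close> is \<open>{0..p - 1}\<close>, so an exponent in \<open>\<int>\<^sub>p\<close> is represented by its
  least nonnegative residue. Since \<open>omega p ^ p = 1\<close>, any other representative gives the same power.
\<close>

definition mu :: "nat \<Rightarrow> (int \<Rightarrow> int) \<Rightarrow> int \<Rightarrow> int \<Rightarrow> complex" where
  "mu p f a b =
     1 / of_nat p * (\<Sum>x\<in>carrier (Zmod p).
       omega p powi (a \<otimes>\<^bsub>Zmod p\<^esub> f x \<oplus>\<^bsub>Zmod p\<^esub> b \<otimes>\<^bsub>Zmod p\<^esub> x))"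

definition linear_polynomial_function :: "nat \<Rightarrow> (int \<Rightarrow> int) \<Rightarrow> bool" where
  "linear_polynomial_function p f \<longleftrightarrow>
     (\<exists>\<alpha>\<in>carrier (Zmod p). \<exists>\<beta>\<in>carrier (Zmod p). \<forall>x\<in>carrier (Zmod p).
        f x = \<alpha> \<otimes>\<^bsub>Zmod p\<^esub> x \<oplus>\<^bsub>Zmod p\<^esub> \<beta>)"

end

theory Submission
  imports Defs "Jordan_Normal_Form.Char_Poly"
begin

text \<open>
  Write \<open>S k b\<close> for the exponential sum \<open>\<Sum>x. \<omega> ^ (k * (f x + b * x))\<close> with \<open>p\<close> terms on the unit circle.
  The numbers \<open>S k b / p\<close> are averages \<open>\<mu>\<close>, hence algebraic integers of modulus at most 1, and for
  fixed \<open>b\<close> those with \<open>0 < k < p\<close> are the Galois conjugates of \<open>S 1 b / p\<close>. Modulus exactly 1 forces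
  all terms of the sum to coincide; then \<open>f x + b * x\<close> is constant modulo \<open>p\<close> and \<open>f\<close> is linear
  (\<open>unit_vectors_eq_if_norm_sum_ge_card\<close>).

  Suppose \<open>f\<close> is not linear. Then every conjugate has modulus strictly below 1, and an algebraic integer
  all of whose conjugates are that small vanishes
  (\<open>poly_root_of_unity_eq_0_if_conjugates_small\<close>). The proof of this avoids Galois theory: the power sums
  \<open>t m = \<Sum>k. \<bar>S k b / p\<bar> ^ (2 * m)\<close> are algebraic integers, are rational because the sum of an integer
  polynomial over all powers of \<open>\<omega>\<close> is an integer, and tend to 0 as \<open>m\<close> grows. So they are integers and
  eventually equal to 0. Therefore \<open>S 1 b = 0\<close> for every \<open>b\<close>, which contradicts
  \<open>(\<Sum>b. S 1 b) = p * \<omega> ^ f 0\<close>, an instance of the orthogonality of additive characters.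

  That algebraic integers are closed under addition and multiplication comes from the characteristic
  polynomial: a number is an algebraic integer once multiplication by it maps some finitely generated
  additive group of numbers, not reduced to 0, into itself (\<open>algebraic_int_if_int_matrix\<close>).
\<close>

(* The component notation for finite Cartesian products clashes with that for matrices and vectors. *)
unbundle no vec_syntax

section \<open>The ring of algebraic integers\<close>

text \<open>
  The hypothesis says that \<open>z\<close> is an eigenvalue of the integer matrix \<open>A\<close> with eigenvector \<open>v\<close>, so \<open>z\<close>
  is a root of the characteristic polynomial of \<open>A\<close>, which is monic with integer coefficients.
\<close>

lemma algebraic_int_if_int_matrix:
  fixes z :: "'a :: field_char_0" and v :: "'i \<Rightarrow> 'a" and A :: "'i \<Rightarrow> 'i \<Rightarrow> int"
  assumes "finite I" and "s \<in> I" and "v s \<noteq> 0"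
    and eig: "\<And>i. i \<in> I \<Longrightarrow> z * v i = (\<Sum>j\<in>I. of_int (A i j) * v j)"
  shows "algebraic_int z"
proof -
  define n where "n = card I"
  obtain h where h: "bij_betw h {0..<n} I"
    using ex_bij_betw_nat_finite[OF \<open>finite I\<close>] unfolding n_def by blast
  define B :: "int mat" where "B = mat n n (\<lambda>(i, j). A (h i) (h j))"
  define C :: "'a mat" where "C = map_mat of_int B"
  define w where "w = vec n (\<lambda>i. v (h i))"
  have B: "B \<in> carrier_mat n n" and C: "C \<in> carrier_mat n n" and w: "w \<in> carrier_vec n"
    by (auto simp: B_def C_def w_def)
  obtain k where k: "k < n" "h k = s"
    using h \<open>s \<in> I\<close> unfolding bij_betw_def by fastforce
  have "w $ k = v s" using k by (simp add: w_def)
  hence "w \<noteq> 0\<^sub>v n" using k \<open>v s \<noteq> 0\<close> by auto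
  moreover have "C *\<^sub>v w = z \<cdot>\<^sub>v w"
  proof (rule eq_vecI)
    fix i assume "i < dim_vec (z \<cdot>\<^sub>v w)"
    hence i: "i < n" by (simp add: w_def)
    hence "h i \<in> I" using h by (auto simp: bij_betw_def)
    have "(C *\<^sub>v w) $ i = (\<Sum>j\<in>{0..<n}. of_int (A (h i) (h j)) * v (h j))"
      using i by (simp add: C_def B_def w_def scalar_prod_def)
    also have "\<dots> = (\<Sum>j\<in>I. of_int (A (h i) j) * v j)"
      by (rule sum.reindex_bij_betw[OF h])
    also have "\<dots> = z * v (h i)" using eig[OF \<open>h i \<in> I\<close>] by simp
    finally show "(C *\<^sub>v w) $ i = (z \<cdot>\<^sub>v w) $ i" using i by (simp add: w_def)
  qed (use C w in auto)
  ultimately have "eigenvalue C z"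
    using C w unfolding eigenvalue_def eigenvector_def by auto
  hence "poly (char_poly C) z = 0" using eigenvalue_root_char_poly[OF C] by simp
  moreover have "char_poly C = map_poly of_int (char_poly B)"
    unfolding C_def by (rule of_int_hom.char_poly_hom[OF B])
  ultimately show ?thesis
    unfolding algebraic_int_altdef_ipoly
    using degree_monic_char_poly[OF B] by (intro exI[of _ "char_poly B"]) auto
qed

text \<open>
  The matrix \<open>a\<close> is the companion matrix of a monic integer polynomial of degree \<open>m\<close> with root \<open>x\<close>: it
  shifts the powers of \<open>x\<close> by one, and the polynomial rewrites \<open>x ^ m\<close> in terms of lower powers.
\<close>

lemma algebraic_int_powers_span:
  fixes x :: "'a :: field_char_0"
  assumes "algebraic_int x"
  obtains m :: nat and a :: "nat \<Rightarrow> nat \<Rightarrow> int" where "m > 0"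
    and "\<And>i. i < m \<Longrightarrow> x * x ^ i = (\<Sum>j<m. of_int (a i j) * x ^ j)"
proof -
  obtain q :: "int poly" where q: "poly (map_poly of_int q) x = 0" "lead_coeff q = 1"
    using assms unfolding algebraic_int_altdef_ipoly by blast
  define m where "m = Polynomial.degree q"
  define a where "a i j = (if Suc i < m then of_bool (j = Suc i) else - Polynomial.coeff q j)" for i j
  have "m > 0"
  proof (rule ccontr)
    assume "\<not> m > 0"
    then obtain c where "q = [:c:]" unfolding m_def by (auto elim: degree_eq_zeroE)
    thus False using q by simp
  qed
  moreover have "x * x ^ i = (\<Sum>j<m. of_int (a i j) * x ^ j)" if "i < m" for i
  proof (cases "Suc i < m")
    case True
    have "(\<Sum>j<m. of_int (a i j) * x ^ j) = (\<Sum>j<m. if j = Suc i then x ^ j else 0)"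
      using True by (intro sum.cong) (auto simp: a_def)
    thus ?thesis using True by simp
  next
    case False
    hence m: "m = Suc i" using that by simp
    have "0 = (\<Sum>j\<le>m. of_int (Polynomial.coeff q j) * x ^ j)"
      using q(1) by (simp add: poly_altdef m_def)
    also have "\<dots> = (\<Sum>j<m. of_int (Polynomial.coeff q j) * x ^ j) + x ^ m"
      using q(2) by (simp add: m_def flip: lessThan_Suc_atMost)
    finally have "x ^ m = - (\<Sum>j<m. of_int (Polynomial.coeff q j) * x ^ j)"
      by (simp add: eq_neg_iff_add_eq_0 add.commute)
    thus ?thesis using m by (simp add: a_def sum_negf)
  qed
  ultimately show ?thesis by (rule that)
qed

text \<open>
  Both the sum and the product map the additive group spanned by the finitely many monomials
  \<open>x ^ i * y ^ j\<close> into itself. On these, \<open>x\<close> and \<open>y\<close> act by the Kronecker products \<open>a \<otimes> 1\<close> and \<open>1 \<otimes> b\<close>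
  of the companion matrices with an identity, so \<open>x + y\<close> acts by their sum and \<open>x * y\<close> by \<open>a \<otimes> b\<close>.
\<close>

lemma
  fixes x y :: "'a :: field_char_0"
  assumes x: "algebraic_int x" and y: "algebraic_int y"
  shows algebraic_int_add: "algebraic_int (x + y)"
    and algebraic_int_mult: "algebraic_int (x * y)"
proof -
  obtain m a where m: "m > 0"
    and a: "\<And>i. i < m \<Longrightarrow> x * x ^ i = (\<Sum>j<m. of_int (a i j) * x ^ j)"
    using algebraic_int_powers_span[OF x] by blast
  obtain n b where n: "n > 0"
    and b: "\<And>i. i < n \<Longrightarrow> y * y ^ i = (\<Sum>j<n. of_int (b i j) * y ^ j)"
    using algebraic_int_powers_span[OF y] by blast
  define I where "I = {..<m} \<times> {..<n}"
  define v :: "nat \<times> nat \<Rightarrow> 'a" where "v = (\<lambda>(i, j). x ^ i * y ^ j)"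
  have I: "finite I" "(0, 0) \<in> I" and v: "v (0, 0) \<noteq> 0"
    using m n by (auto simp: I_def v_def)
  show "algebraic_int (x * y)"
  proof (rule algebraic_int_if_int_matrix[where I = I and v = v and s = "(0, 0)"
      and A = "\<lambda>(i, j) (i', j'). a i i' * b j j'"])
    fix ij assume "ij \<in> I"
    then obtain i j where ij: "ij = (i, j)" "i < m" "j < n" by (auto simp: I_def)
    have "x * y * v ij = (x * x ^ i) * (y * y ^ j)" by (simp add: ij v_def)
    also have "\<dots> = (\<Sum>s\<in>I. of_int ((\<lambda>(i, j) (i', j'). a i i' * b j j') ij s) * v s)"
      unfolding a[OF ij(2)] b[OF ij(3)] sum_product I_def
      by (simp add: sum.cartesian_product ij v_def case_prod_unfold mult_ac)
    finally show "x * y * v ij = \<dots>" .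
  qed (use I v in auto)
  show "algebraic_int (x + y)"
  proof (rule algebraic_int_if_int_matrix[where I = I and v = v and s = "(0, 0)"
      and A = "\<lambda>(i, j) (i', j'). a i i' * of_bool (j' = j) + of_bool (i' = i) * b j j'"])
    fix ij assume "ij \<in> I"
    then obtain i j where ij: "ij = (i, j)" "i < m" "j < n" by (auto simp: I_def)
    have x_i: "x ^ i = (\<Sum>i'<m. of_bool (i' = i) * x ^ i')"
      using ij by (simp add: of_bool_def if_distrib[of "\<lambda>t. t * _"] cong: if_cong)
    have y_j: "y ^ j = (\<Sum>j'<n. of_bool (j' = j) * y ^ j')"
      using ij by (simp add: of_bool_def if_distrib[of "\<lambda>t. t * _"] cong: if_cong)
    have "(x + y) * v ij = (x * x ^ i) * y ^ j + x ^ i * (y * y ^ j)"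
      by (simp add: ij v_def algebra_simps)
    also have "\<dots> =
        (\<Sum>i'<m. of_int (a i i') * x ^ i') * (\<Sum>j'<n. of_bool (j' = j) * y ^ j') +
        (\<Sum>i'<m. of_bool (i' = i) * x ^ i') * (\<Sum>j'<n. of_int (b j j') * y ^ j')"
      by (intro arg_cong2[of _ _ _ _ "(+)"] arg_cong2[of _ _ _ _ "(*)"] a b x_i y_j ij)
    finally have "(x + y) * v ij = \<dots>" .
    thus "(x + y) * v ij = (\<Sum>s\<in>I. of_int ((\<lambda>(i, j) (i', j').
        a i i' * of_bool (j' = j) + of_bool (i' = i) * b j j') ij s) * v s)"
      unfolding sum_product I_def
      by (simp add: sum.cartesian_product ij v_def case_prod_unfold sum.distrib algebra_simps)
  qed (use I v in auto)
qed

lemma algebraic_int_sum: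
  fixes g :: "'i \<Rightarrow> 'a :: field_char_0"
  assumes "\<And>i. i \<in> I \<Longrightarrow> algebraic_int (g i)"
  shows "algebraic_int (\<Sum>i\<in>I. g i)"
  using assms by (induction I rule: infinite_finite_induct) (auto intro: algebraic_int_add)

lemma algebraic_int_pow:
  fixes x :: "'a :: field_char_0"
  assumes "algebraic_int x"
  shows "algebraic_int (x ^ n)"
  by (induction n) (auto intro: algebraic_int_mult assms)

section \<open>Algebraic integers with small conjugates\<close>

text \<open>
  This replaces the rationality of a Galois trace. Exchanging the sums leaves geometric sums of
  \<open>w ^ i\<close>, each equal to \<open>n\<close> or 0.
\<close>

lemma sum_poly_roots_of_unity_int:
  fixes w :: complex and R :: "int poly"
  assumes "w ^ n = 1"
  shows "(\<Sum>k<n. poly (map_poly of_int R) (w ^ k)) \<in> \<int>"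
proof -
  have geom: "(\<Sum>k<n. (w ^ i) ^ k) \<in> \<int>" for i
  proof (cases "w ^ i = 1")
    case False
    have "(w ^ i) ^ n = 1" using assms by (metis power_commutes power_mult power_one mult.commute)
    thus ?thesis using geometric_sum[OF False, of n] by simp
  qed simp
  have "(\<Sum>k<n. poly (map_poly of_int R) (w ^ k)) =
      (\<Sum>k<n. \<Sum>i\<le>Polynomial.degree R. of_int (Polynomial.coeff R i) * (w ^ i) ^ k)"
    by (simp add: poly_altdef mult.commute flip: power_mult)
  also have "\<dots> = (\<Sum>i\<le>Polynomial.degree R. of_int (Polynomial.coeff R i) * (\<Sum>k<n. (w ^ i) ^ k))"
    by (subst sum.swap) (simp add: sum_distrib_left)
  also have "\<dots> \<in> \<int>" by (intro Ints_sum Ints_mult geom) auto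
  finally show ?thesis .
qed

text \<open>
  The even power sums \<open>t m\<close> of the moduli of the values \<open>Q (w ^ k) / N\<close> are integers that tend to 0.
  Moduli are used instead of the values themselves so that \<open>t m = 0\<close> makes every single summand vanish. The
  denominator \<open>N\<close> does no harm: it becomes \<open>N ^ (2 * m)\<close>, and \<open>t m\<close> stays rational.
\<close>

lemma poly_root_of_unity_eq_0_if_conjugates_small:
  fixes w :: complex and Q :: "int poly" and N :: nat
  assumes w: "w ^ n = 1" and "n > 0" "N > 0"
    and int: "\<And>k. k \<in> {1..<n} \<Longrightarrow> algebraic_int (poly (map_poly of_int Q) (w ^ k) / of_nat N)"
    and small: "\<And>k. k \<in> {1..<n} \<Longrightarrow> cmod (poly (map_poly of_int Q) (w ^ k)) < N"
    and k: "k \<in> {1..<n}"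
  shows "poly (map_poly of_int Q) (w ^ k) = 0"
proof -
  define z where "z k = poly (map_poly of_int Q) (w ^ k) / of_nat N" for k
  define t where "t m = (\<Sum>k\<in>{1..<n}. (cmod (z k) ^ 2) ^ m)" for m
  have z_small: "cmod (z k) < 1" if "k \<in> {1..<n}" for k
    using small[OF that] \<open>N > 0\<close> by (simp add: z_def norm_divide)
  have "t \<longlonglongrightarrow> (\<Sum>k\<in>{1..<n}. 0)"
    unfolding t_def
    by (intro tendsto_sum LIMSEQ_realpow_zero) (use z_small in \<open>auto simp: power_less_one_iff abs_square_less_1\<close>)
  hence "eventually (\<lambda>m. t m < 1) sequentially"
    by (intro order_tendstoD(2)[where y = 0]) auto
  then obtain m where m: "m > 0" "t m < 1"
    unfolding eventually_sequentially by (metis less_Suc_eq_le less_eq_Suc_le linorder_le_cases zero_less_Suc)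
  have norm_sq: "of_real (cmod (z k) ^ 2) = z k * cnj (z k)" for k
    by (simp add: complex_norm_square[symmetric])
  have t_eq: "of_real (t m) = (\<Sum>k\<in>{1..<n}. (z k * cnj (z k)) ^ m)"
    by (simp only: t_def of_real_sum of_real_power[of _ m] norm_sq)
  have "algebraic_int (of_real (t m) :: complex)"
    unfolding t_eq
    by (intro algebraic_int_sum algebraic_int_pow algebraic_int_mult algebraic_int_cnj)
      (use int in \<open>auto simp: z_def\<close>)
  moreover have "of_real (t m) \<in> (\<rat> :: complex set)"
  proof -
    \<comment> \<open>Conjugation sends \<open>w\<close> to \<open>w ^ (n - 1)\<close>, so \<open>R\<close> takes the value
      \<open>\<bar>Q (w ^ k)\<bar> ^ (2 * m)\<close> at \<open>w ^ k\<close>.\<close>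
    define R where "R = (Q * pcompose Q (Polynomial.monom 1 (n - 1))) ^ m"
    have cnj_w: "cnj w = w ^ (n - 1)"
    proof -
      have "cmod w = 1"
        using w \<open>n > 0\<close>
        by (metis norm_one norm_power power_eq_1_iff gr0_implies_Suc nat.distinct(1) norm_ge_zero
            abs_norm_cancel)
      hence "w * cnj w = 1" by (simp add: complex_norm_square[symmetric])
      moreover have "w * w ^ (n - 1) = 1" using w \<open>n > 0\<close> by (simp add: power_eq_if)
      ultimately show ?thesis by (metis mult_cancel_left mult_zero_left zero_neq_one)
    qed
    have "cnj (poly (map_poly of_int Q) (w ^ k)) = poly (map_poly of_int Q) (cnj (w ^ k))" for k
      by (simp add: poly_altdef)
    hence "poly (map_poly of_int R) (w ^ k) =
        (poly (map_poly of_int Q) (w ^ k) * cnj (poly (map_poly of_int Q) (w ^ k))) ^ m" for k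
      by (simp add: R_def hom_distribs of_int_poly_hom.hom_power of_int_hom.map_poly_pcompose
          poly_pcompose poly_monom cnj_w mult.commute flip: power_mult)
    hence R: "poly (map_poly of_int R) (w ^ k) = of_nat N ^ (2 * m) * (z k * cnj (z k)) ^ m" for k
      using \<open>N > 0\<close>
      by (simp add: z_def power_mult power2_eq_square flip: power_mult_distrib)
    \<comment> \<open>The full sum over all powers of \<open>w\<close> includes \<open>k = 0\<close>, where \<open>Q\<close> need not be small; that
      summand is an integer and is subtracted.\<close>
    have "(\<Sum>k<n. poly (map_poly of_int R) (w ^ k)) =
        poly (map_poly of_int R) 1 + (\<Sum>k\<in>{1..<n}. poly (map_poly of_int R) (w ^ k))"
      using \<open>n > 0\<close> by (simp add: lessThan_atLeast0 sum.atLeast_Suc_lessThan)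
    also have "(\<Sum>k\<in>{1..<n}. poly (map_poly of_int R) (w ^ k)) = of_nat N ^ (2 * m) * of_real (t m)"
      unfolding R t_eq by (simp add: sum_distrib_left)
    finally have "of_real (t m) = ((\<Sum>k<n. poly (map_poly of_int R) (w ^ k)) -
        of_int (poly R 1)) / of_nat N ^ (2 * m)"
      using \<open>N > 0\<close> by (simp add: field_simps)
    moreover have "\<dots> \<in> \<rat>"
      using sum_poly_roots_of_unity_int[OF w, of R] Ints_subset_Rats
      by (intro Rats_divide Rats_diff) auto
    ultimately show ?thesis by simp
  qed
  ultimately have "of_real (t m) \<in> (\<int> :: complex set)" by (rule rational_algebraic_int_is_int)
  then obtain c :: int where c: "t m = of_int c"
    by (metis Ints_cases of_real_of_int_eq of_real_eq_iff)
  have "t m \<ge> 0" by (auto simp: t_def intro: sum_nonneg)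
  hence "t m = 0" using c m(2) by simp
  hence "(cmod (z k) ^ 2) ^ m = 0"
    using k unfolding t_def by (subst (asm) sum_nonneg_eq_0_iff) auto
  thus ?thesis using \<open>m > 0\<close> \<open>N > 0\<close> by (simp add: z_def)
qed

section \<open>Exponential sums\<close>

text \<open>
  The equality case of the triangle inequality: two different unit vectors have a sum of norm less than
  2, and the remaining terms contribute at most 1 each.
\<close>

lemma unit_vectors_eq_if_norm_sum_ge_card:
  fixes u :: "'i \<Rightarrow> complex"
  assumes "finite X" "\<And>x. x \<in> X \<Longrightarrow> norm (u x) = 1" "norm (\<Sum>x\<in>X. u x) \<ge> card X"
    and "x \<in> X" "y \<in> X"
  shows "u x = u y"
proof (cases "x = y")
  case False
  have "(\<Sum>s\<in>X. u s) = u x + u y + (\<Sum>s\<in>X - {x, y}. u s)"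
    using assms False by (simp add: sum.subset_diff[of "{x, y}" X])
  hence "card X \<le> norm (u x + u y) + norm (\<Sum>s\<in>X - {x, y}. u s)"
    using assms(3) norm_triangle_ineq[of "u x + u y" "\<Sum>s\<in>X - {x, y}. u s"] by simp
  also have "norm (\<Sum>s\<in>X - {x, y}. u s) \<le> (\<Sum>s\<in>X - {x, y}. 1)"
    by (rule sum_norm_le) (use assms in auto)
  also have "\<dots> = card X - 2"
    using assms False by (simp add: card_Diff_subset)
  finally have "norm (u x + u y) \<ge> 2"
    using card_mono[OF \<open>finite X\<close>, of "{x, y}"] assms False by auto
  moreover have "norm (u x + u y) \<le> norm (u x) + norm (u y)" by (rule norm_triangle_ineq)
  ultimately have "norm (u x + u y) = norm (u x) + norm (u y)"
    using assms by simp
  hence "norm (u x) *\<^sub>R u y = norm (u y) *\<^sub>R u x" by (simp only: norm_triangle_eq)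
  thus ?thesis using assms by simp
qed simp

lemma omega_powi_eq_iff:
  assumes "p > 0"
  shows "omega p powi i = omega p powi j \<longleftrightarrow> [i = j] (mod int p)"
proof -
  have "omega p powi i = exp (2 * complex_of_real pi * \<i> * of_int i / of_nat p)" for i
    by (simp add: omega_def exp_power_int mult_ac)
  moreover have "2 * complex_of_real pi * \<i> * of_int j / of_nat p + of_int (2 * n) * pi * \<i> =
      2 * complex_of_real pi * \<i> * of_int (j + n * int p) / of_nat p" for n
    using assms by (simp add: field_simps)
  ultimately have "omega p powi i = omega p powi j \<longleftrightarrow>
      (\<exists>n. 2 * complex_of_real pi * \<i> * of_int i / of_nat p =
        2 * complex_of_real pi * \<i> * of_int (j + n * int p) / of_nat p)"
    by (simp only: exp_eq)
  also have "\<dots> \<longleftrightarrow> (\<exists>n. complex_of_int i = of_int (j + n * int p))"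
    using assms by simp
  also have "\<dots> \<longleftrightarrow> (\<exists>n. i = j + n * int p)"
    by (simp only: of_int_eq_iff)
  also have "\<dots> \<longleftrightarrow> [i = j] (mod int p)"
    by (metis cong_iff_lin cong_sym mult.commute)
  finally show ?thesis .
qed

theorem corollary10:
  fixes p :: nat and f :: "int \<Rightarrow> int"
  assumes "prime p"
    and "f \<in> carrier (Zmod p) \<rightarrow> carrier (Zmod p)"
    and "\<And>a b. a \<in> carrier (Zmod p) \<Longrightarrow> b \<in> carrier (Zmod p) \<Longrightarrow> algebraic_int (mu p f a b)"
  shows "linear_polynomial_function p f"
proof (rule ccontr)
  assume not_linear: "\<not> linear_polynomial_function p f"
  have "p > 1" using \<open>prime p\<close> by (rule prime_gt_1_nat)
  hence p: "p > 0" by simp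
  define X where "X = {0..<int p}"
  have carrier: "carrier (Zmod p) = X" by (auto simp: residue_ring_def X_def)
  have card_X: "finite X" "card X = p" by (auto simp: X_def)
  define w where "w = omega p"
  note w_eq = omega_powi_eq_iff[OF p, folded w_def]
  have w_mod: "w powi (c mod int p) = w powi c" for c by (simp add: w_eq cong_def)
  have w_nz: "w \<noteq> 0" by (simp add: w_def omega_def)
  have w_p: "w ^ p = 1" using w_eq[of "int p" 0] by (simp add: cong_def)
  have norm_w: "cmod (w powi c) = 1" for c
    by (simp add: w_def omega_def norm_power_int)
  \<comment> \<open>In this parametrisation \<open>S k b / p\<close> is the average for \<open>a = k\<close> and \<open>k * b\<close> in place of \<open>b\<close>, so
    that changing \<open>k\<close> amounts to passing to a conjugate.\<close>
  define S where "S k b = (\<Sum>x\<in>X. w powi (k * (f x + b * x)))" for k b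
  have mu: "mu p f (k mod int p) ((k * b) mod int p) = S k b / of_nat p" for k b
    unfolding mu_def carrier w_def[symmetric] S_def
    by (simp add: residue_ring_def sum_divide_distrib w_mod mod_simps algebra_simps)
  have S_int: "algebraic_int (S k b / of_nat p)" for k b
    unfolding mu[symmetric] by (rule assms(3)) (use p in \<open>auto simp: carrier X_def\<close>)
  have S_small: "cmod (S k b) < p" if "coprime k (int p)" for k b
  proof (rule ccontr)
    assume "\<not> cmod (S k b) < p"
    hence eq: "w powi (k * (f x + b * x)) = w powi (k * (f 0 + b * 0))" if "x \<in> X" for x
      using that p card_X norm_w unfolding S_def
      by (intro unit_vectors_eq_if_norm_sum_ge_card[of X "\<lambda>x. w powi (k * (f x + b * x))"])
        (auto simp: X_def)
    have "f x = ((- b) mod int p * x mod int p + f 0) mod int p" if "x \<in> X" for x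
    proof -
      have "[f x + b * x = f 0 + b * 0] (mod int p)"
        using eq[OF that] unfolding w_eq
        using \<open>coprime k (int p)\<close> cong_mult_lcancel by blast
      hence "[f x = - b * x + f 0] (mod int p)"
        by (simp add: cong_iff_dvd_diff algebra_simps)
      moreover have "f x mod int p = f x"
        using assms(2) that by (auto simp: carrier X_def Pi_iff)
      ultimately show ?thesis by (simp add: cong_def mod_simps)
    qed
    moreover have "(- b) mod int p \<in> X" "f 0 \<in> X"
      using p assms(2) by (auto simp: carrier Pi_iff) (auto simp: X_def)
    ultimately have "linear_polynomial_function p f"
      unfolding linear_polynomial_function_def carrier
      by (intro bexI[of _ "(- b) mod int p"] bexI[of _ "f 0"]) (auto simp: residue_ring_def)
    with not_linear show False ..
  qed
  \<comment> \<open>\<open>S k b\<close> is the value at \<open>\<omega> ^ k\<close> of one integer polynomial \<open>Q\<close> that does not depend on \<open>k\<close>.\<close>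
  have S_0: "S 1 b = 0" for b
  proof -
    define Q :: "int poly" where "Q = (\<Sum>x\<in>X. Polynomial.monom 1 (nat ((f x + b * x) mod int p)))"
    have Q: "poly (map_poly of_int Q) (w ^ k) = S (int k) b" for k
    proof -
      have "(w ^ k) ^ nat ((f x + b * x) mod int p) = w powi (int k * (f x + b * x))" for x
      proof -
        have "(w ^ k) ^ nat ((f x + b * x) mod int p) = w powi (int k * ((f x + b * x) mod int p))"
          using p by (simp add: power_int_def nat_mult_distrib power_mult)
        also have "\<dots> = w powi (int k * (f x + b * x))"
          by (simp add: w_eq cong_def mod_simps)
        finally show ?thesis .
      qed
      thus ?thesis
        by (simp add: Q_def S_def of_int_hom.map_poly_hom_monom of_int_poly_hom.hom_sum poly_sum poly_monom)
    qed
    have "poly (map_poly of_int Q) (w ^ 1) = 0"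
    proof (rule poly_root_of_unity_eq_0_if_conjugates_small[OF w_p p p])
      fix k assume k: "k \<in> {1..<p}"
      show "algebraic_int (poly (map_poly of_int Q) (w ^ k) / of_nat p)"
        unfolding Q by (rule S_int)
      have "\<not> p dvd k" using k by (auto dest: dvd_imp_le)
      hence "coprime p k" by (rule prime_imp_coprime[OF \<open>prime p\<close>])
      hence "coprime (int k) (int p)" by (metis coprime_commute coprime_int_iff)
      thus "cmod (poly (map_poly of_int Q) (w ^ k)) < p"
        unfolding Q by (rule S_small)
    qed (use \<open>p > 1\<close> in auto)
    thus ?thesis unfolding Q by simp
  qed
  have geom: "(\<Sum>b\<in>X. w powi (b * x)) = 0" if "x \<in> X - {0}" for x
  proof -
    have "w powi x \<noteq> w powi 0"
      unfolding w_eq using that by (auto simp: X_def cong_def)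
    moreover have "(w powi x) ^ p = 1"
      using w_eq[of "x * int p" 0] by (simp add: power_int_mult cong_def)
    ultimately have "(\<Sum>b<p. (w powi x) ^ b) = 0"
      by (simp add: geometric_sum)
    also have "(\<Sum>b<p. (w powi x) ^ b) = (\<Sum>b\<in>X. w powi (b * x))"
      by (rule sum.reindex_bij_witness[of _ nat int])
        (auto simp: X_def power_int_mult mult.commute[of _ x])
    finally show ?thesis .
  qed
  \<comment> \<open>Summing over all \<open>b\<close> isolates the term \<open>x = 0\<close>.\<close>
  have "0 = (\<Sum>b\<in>X. S 1 b)" by (simp add: S_0)
  also have "\<dots> = (\<Sum>x\<in>X. w powi f x * (\<Sum>b\<in>X. w powi (b * x)))"
    unfolding S_def by (subst sum.swap) (simp add: power_int_add w_nz sum_distrib_left)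
  also have "\<dots> = (\<Sum>x\<in>{0}. w powi f x * (\<Sum>b\<in>X. w powi (b * x)))"
    using p by (intro sum.mono_neutral_right) (auto simp: geom card_X, auto simp: X_def)
  also have "\<dots> = w powi f 0 * of_nat p" by (simp add: card_X)
  finally show False using p w_nz by (simp add: power_int_eq_0_iff)
qed

end
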